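(* In any arc of $S^1$ there is a closed set $\Theta$ of one-dimensional measure $0$ (contained in that arc) which is good.
   Context: An arc of the unit circle $S^1$ means a connected subset of $S^1$ of positive length. One-dimensional measure is arc-length (Lebesgue) measure on $S^1$, which is identified with the set of angles (mod $2\pi$). A lattice in $\mathbb{R}^2$ is a discrete subgroup of rank 2. $B_\epsilon(0)=\{x\in\mathbb{R}^2:|x|<\epsilon\}$. $R_\theta$ denotes rotation of $\mathbb{R}^2$ about the origin by the angle $\theta$, and $R_\Theta E = \{R_\theta x: \theta\in\Theta, x\in E\}$. A set $\Theta\subseteq S^1$ is called $(\Lambda,\epsilon)$-good if $R_\Theta E$ contains the complement of a disk, where $E=\Lambda+B_\epsilon(0)$; it is called good if it is $(\Lambda,\epsilon)$-good for all lattices $\Lambda\subseteq\mathbb{R}^2$ and all $\epsilon>0$. *)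

theory Defs
  imports "HOL-Analysis.Analysis"
begin

text \<open>The unit circle is the unit sphere of the Euclidean plane, and an angle (mod \<open>2\<pi>\<close>)
  is identified with the point of the circle in that direction.\<close>

abbreviation S1 :: "(real^2) set" where
  "S1 \<equiv> sphere 0 1"

definition circle_point :: "real \<Rightarrow> real^2" where
  "circle_point t = vector [cos t, sin t]"

definition arc_length :: "(real^2) measure" where
  "arc_length = distr (restrict_space lborel {0..<2 * pi}) (restrict_space borel S1) circle_point"

text \<open>All connected subsets of the circle are Borel, so the default value \<open>0\<close> of \<^const>\<open>emeasure\<close> on
  non-measurable sets does not exclude any arc.\<close>

definition arc_of_circle :: "(real^2) set \<Rightarrow> bool" where
  "arc_of_circle A \<longleftrightarrow> A \<subseteq> S1 \<and> connected A \<and> emeasure arc_length A > 0"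

definition rotation :: "real \<Rightarrow> real^2 \<Rightarrow> real^2" where
  "rotation t x = vector [cos t * x$1 - sin t * x$2, sin t * x$1 + cos t * x$2]"

definition rotations :: "(real^2) set \<Rightarrow> (real^2) set \<Rightarrow> (real^2) set" where
  "rotations \<Theta> E = {rotation t x | t x. circle_point t \<in> \<Theta> \<and> x \<in> E}"

text \<open>The plane as a module over the integers; this supplies linear independence over \<open>\<int>\<close>.\<close>

global_interpretation zmod: module "\<lambda>(k::int) (x::real^2). of_int k *\<^sub>R x"
  by unfold_locales (simp_all add: algebra_simps)

definition has_rank :: "(real^2) set \<Rightarrow> nat \<Rightarrow> bool" where
  "has_rank G n \<longleftrightarrow>
     (\<exists>B\<subseteq>G. finite B \<and> card B = n \<and> zmod.independent B) \<and>
     (\<forall>B\<subseteq>G. finite B \<and> zmod.independent B \<longrightarrow> card B \<le> n)"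

definition lattice :: "(real^2) set \<Rightarrow> bool" where
  "lattice \<Lambda> \<longleftrightarrow>
     0 \<in> \<Lambda> \<and> (\<forall>x\<in>\<Lambda>. \<forall>y\<in>\<Lambda>. x + y \<in> \<Lambda>) \<and> (\<forall>x\<in>\<Lambda>. - x \<in> \<Lambda>) \<and>
     discrete \<Lambda> \<and> has_rank \<Lambda> 2"

definition good_for :: "(real^2) set \<Rightarrow> real \<Rightarrow> (real^2) set \<Rightarrow> bool" where
  "good_for \<Lambda> \<epsilon> \<Theta> \<longleftrightarrow>
     (\<exists>c r. r > 0 \<and> - ball c r \<subseteq> rotations \<Theta> {x + y | x y. x \<in> \<Lambda> \<and> y \<in> ball 0 \<epsilon>})"

definition good :: "(real^2) set \<Rightarrow> bool" where
  "good \<Theta> \<longleftrightarrow> \<Theta> \<subseteq> S1 \<and> (\<forall>\<Lambda> \<epsilon>. lattice \<Lambda> \<and> \<epsilon> > 0 \<longrightarrow> good_for \<Lambda> \<epsilon> \<Theta>)"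

text \<open>Since \<^const>\<open>distr\<close> is only meaningful for measurable maps, measurability and the total
  length of the circle are checked here.\<close>

lemma circle_point_measurable:
  "circle_point \<in> restrict_space lborel {0..<2 * pi} \<rightarrow>\<^sub>M restrict_space borel S1"
proof (rule measurable_restrict_space1, rule measurable_restrict_space2)
  show "circle_point \<in> space lborel \<rightarrow> S1"
    by (auto simp: circle_point_def norm_vec_def L2_set_def sum_2)
  have eq: "circle_point = (\<lambda>t. cos t *\<^sub>R axis 1 1 + sin t *\<^sub>R axis 2 1)"
    by (auto simp: circle_point_def fun_eq_iff vec_eq_iff forall_2 axis_def)
  have "continuous_on UNIV circle_point"
    unfolding eq by (intro continuous_intros)
  then show "circle_point \<in> lborel \<rightarrow>\<^sub>M borel"
    using borel_measurable_continuous_onI by simp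
qed

lemma emeasure_arc_length_S1: "emeasure arc_length S1 = ennreal (2 * pi)"
proof -
  have "circle_point -` S1 \<inter> space (restrict_space lborel {0..<2 * pi}) = {0..<2 * pi}"
    by (auto simp: circle_point_def norm_vec_def L2_set_def sum_2 space_restrict_space)
  moreover have "S1 \<in> sets (restrict_space borel S1)"
    by (auto simp: sets_restrict_space)
  ultimately show ?thesis
    unfolding arc_length_def
    by (simp add: emeasure_distr[OF circle_point_measurable] emeasure_restrict_space)
qed

end

(* Let S be the Cantor set of real numbers whose factorial-base digits are never maximal (from some
   position on). The proportion 1/n removed at stage n tends to 0, but the sum of the 1/n diverges:
   S is null, yet at scale 1/n! its gaps are negligible relative to its cells.

   A point x at distance r from 0 is rotated into the lattice neighbourhood by some angle of S iff the
   arc {R_{-t} x : t in S} meets that neighbourhood. Choose n with 2 L n! <= r < 2 L (n+1)!. The part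
   of the arc coming from one cell of length 1/n! is then a nearly straight segment of length at
   least L, up to gaps of size O(L/n), in a direction determined by x and by the cell. As S is
   uncountable, some cell has a direction that is irrational with respect to the lattice, and a segment
   in such a direction meets the lattice neighbourhood as soon as its length L is large enough;
   compactness in the direction of x makes L uniform. *)

theory Submission
  imports Defs
begin

section \<open>The factorial Cantor set and its digits\<close>

text \<open>Numbers whose factorial-base digits after position \<open>m\<close> are never maximal: at stage \<open>i\<close> the last
  of the \<open>i\<close> subcells of length \<open>1/i!\<close> is removed. This set is not closed, only its closure is used.\<close>

definition factorial_cantor :: "nat \<Rightarrow> real set" where
  "factorial_cantor m = {t. \<forall>i>m. \<lfloor>t * fact i\<rfloor> mod int i \<noteq> int i - 1}"

text \<open>Since \<open>fact n div fact i\<close> is a positive integer, taking the floor before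
  dividing by it changes nothing: the cell of \<open>t\<close> at stage \<open>n\<close> determines
  all its coarser cells and hence its earlier digits.\<close>

lemma floor_fact_div:
  fixes t :: real
  assumes "i \<le> n"
  shows "\<lfloor>t * fact i\<rfloor> = \<lfloor>t * fact n\<rfloor> div (fact n div fact i)"
proof -
  have dvd: "(fact i :: int) dvd fact n" using assms by (rule fact_dvd)
  have "of_int (fact n div fact i) = (fact n / fact i :: real)"
    using real_of_int_div[OF dvd] by simp
  then have "t * fact i = t * fact n / of_int (fact n div fact i)"
    by simp
  then show ?thesis
    using floor_divide_real_eq_div[of "fact n div fact i" "t * fact n"]
    by (simp add: pos_imp_zdiv_nonneg_iff)
qed

lemma floor_fact_Suc_div:
  fixes t :: real
  shows "\<lfloor>t * fact n\<rfloor> = \<lfloor>t * fact (Suc n)\<rfloor> div (int n + 1)"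
proof -
  have "t * fact n = t * fact (Suc n) / of_int (int n + 1)"
    by (simp add: divide_simps)
  then show ?thesis
    using floor_divide_real_eq_div[of "int n + 1" "t * fact (Suc n)"] by (simp del: fact_Suc)
qed

text \<open>Below a surviving cell the next two factorial digits \<open>c\<close> and \<open>d\<close> are free up to the maximal one,
  and all later digits of \<open>q\<close> are zero.\<close>

lemma factorial_cantor_extend:
  assumes t: "t \<in> factorial_cantor m" and "m \<le> n"
    and c: "0 \<le> c" "c < int n" and d: "0 \<le> d" "d \<le> int n"
    and k: "k = \<lfloor>t * fact n\<rfloor>"
    and q: "q = of_int (k * (int n + 1) * (int n + 2) + c * (int n + 2) + d) / fact (n + 2)"
  shows "q \<in> factorial_cantor m" and "\<lfloor>q * fact n\<rfloor> = k"
proof -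
  define j where "j = k * (int n + 1) * (int n + 2) + c * (int n + 2) + d"
  have qj: "q * fact (n + 2) = of_int j"
    using q by (simp add: j_def del: fact_Suc)
  have f2: "\<lfloor>q * fact (n + 2)\<rfloor> = j" by (simp only: qj floor_of_int)
  have j': "j = (k * (int n + 1) + c) * (int n + 2) + d" by (simp add: j_def algebra_simps)
  have "j div (int n + 2) = k * (int n + 1) + c"
    unfolding j' using d by simp
  then have f1: "\<lfloor>q * fact (Suc n)\<rfloor> = k * (int n + 1) + c"
    using floor_fact_Suc_div[of q "Suc n"] f2 by (simp add: add.commute del: fact_Suc)
  have "(k * (int n + 1) + c) div (int n + 1) = k" using c by simp
  then show f0: "\<lfloor>q * fact n\<rfloor> = k"
    using floor_fact_Suc_div[of q n] f1 by simp
  have "\<lfloor>q * fact i\<rfloor> mod int i \<noteq> int i - 1" if "i > m" for i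
  proof -
    consider "i \<le> n" | "i = n + 1" | "i = n + 2" | "i \<ge> n + 3" by linarith
    then show ?thesis
    proof cases
      case 1
      then show ?thesis
        using t that floor_fact_div[OF 1] f0 k by (auto simp: factorial_cantor_def)
    next
      case 2
      have "(k * (int n + 1) + c) mod (int n + 1) = c" using c by simp
      then show ?thesis using 2 f1 c by (simp add: add.commute del: fact_Suc)
    next
      case 3
      have "j mod (int n + 2) = d" unfolding j' using d by simp
      then show ?thesis using 3 f2 d by (simp add: add.commute del: fact_Suc)
    next
      case 4
      then obtain l where l: "i = Suc l" "n + 2 \<le> l" by (cases i) auto
      obtain w :: int where w: "fact l = fact (n + 2) * w"
        using fact_dvd[OF l(2), where 'a = int] by (auto elim: dvdE)
      have "q * fact i = q * of_int (fact l) * i" using l by (simp del: fact_Suc add: fact_Suc[of l])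
      also have "\<dots> = of_int (j * w * int i)"
        unfolding w using qj by (simp del: fact_Suc)
      finally have "\<lfloor>q * fact i\<rfloor> = j * w * int i" by (metis floor_of_int)
      then show ?thesis using l by simp
    qed
  qed
  then show "q \<in> factorial_cantor m" by (simp add: factorial_cantor_def)
qed

text \<open>Cutting the expansion of \<tau> after two further digits gives a point of the set, once
  a maximal second digit is lowered by one. The upper bound on \<tau> keeps it out of the last
  subcell, so that the first of the two digits is not maximal.\<close>

lemma factorial_cantor_approx:
  assumes t: "t \<in> factorial_cantor m" and mn: "m \<le> n"
    and k: "k = \<lfloor>t * fact n\<rfloor>"
    and \<tau>: "of_int k / fact n \<le> \<tau>" "\<tau> < of_int k / fact n + n / fact (n + 1)"
  obtains q where "q \<in> factorial_cantor m" "\<lfloor>q * fact n\<rfloor> = k" "\<bar>q - \<tau>\<bar> \<le> 2 / fact (n + 2)"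
proof -
  define F :: real where "F = fact (n + 2)"
  have F0: "F > 0" by (simp add: F_def del: fact_Suc)
  define u where "u = \<tau> - of_int k / fact n"
  have Fn: "F = (real n + 2) * (real n + 1) * fact n" by (simp add: F_def algebra_simps)
  have kF: "of_int k / fact n = of_int (k * (int n + 1) * (int n + 2)) / F"
    by (simp add: Fn divide_simps)
  \<comment> \<open>\<open>b\<close> counts the whole units \<open>1 / fact (n + 2)\<close> in
    \<open>u\<close>; its quotient and remainder by \<open>n + 2\<close> are the next two digits of
    \<tau>.\<close>
  define b where "b = \<lfloor>u * F\<rfloor>"
  have "u < n / fact (n + 1)" using \<tau> by (simp add: u_def)
  then have "u * F < n / fact (n + 1) * F" using F0 by (rule mult_strict_right_mono)
  also have "\<dots> = n * (n + 2)" by (simp add: Fn divide_simps) (simp add: algebra_simps)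
  finally have "of_int b < (of_int (int n * (int n + 2)) :: real)"
    unfolding b_def using of_int_floor_le[of "u * F"]
    by (simp add: algebra_simps) linarith
  then have b1: "b < int n * (int n + 2)" by linarith
  have b0: "b \<ge> 0" using \<tau> F0 by (simp add: b_def u_def)
  have bu: "of_int b \<le> u * F" "u * F < of_int b + 1" by (simp_all add: b_def)
  define c where "c = b div (int n + 2)"
  define d' where "d' = b mod (int n + 2)"
  have bcd: "b = c * (int n + 2) + d'" by (simp only: c_def d'_def div_mult_mod_eq)
  have d': "0 \<le> d'" "d' < int n + 2" by (simp_all add: d'_def)
  have c: "0 \<le> c" using b0 by (simp add: c_def pos_imp_zdiv_nonneg_iff)
  have "c * (int n + 2) < int n * (int n + 2)" using b1 bcd d'(1) by linarith
  then have "c < int n" by simp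
  note c = c this
  \<comment> \<open>Lowering the forbidden digit \<open>n + 1\<close> costs one unit, and truncating
    \<open>u * F\<close> costs less than one more; this gives the bound of two units.\<close>
  define d where "d = (if d' = int n + 1 then int n else d')"
  have d: "0 \<le> d" "d \<le> int n" "d \<le> d'" "d' \<le> d + 1" using d' by (auto simp: d_def)
  define q where "q = of_int (k * (int n + 1) * (int n + 2) + c * (int n + 2) + d) / F"
  have "q - \<tau> = of_int (c * (int n + 2) + d) / F - u"
    unfolding q_def u_def kF by (simp add: add_divide_distrib)
  also have "\<dots> = (of_int (c * (int n + 2) + d) - u * F) / F"
    using F0 by (simp add: diff_divide_distrib)
  finally have eq: "q - \<tau> = (of_int (c * (int n + 2) + d) - u * F) / F" .
  have 1: "of_int (c * (int n + 2) + d) \<le> (of_int b :: real)"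
    "(of_int b :: real) \<le> of_int (c * (int n + 2) + d) + 1"
    unfolding bcd using d(3,4) by auto
  have "\<bar>of_int (c * (int n + 2) + d) - u * F\<bar> \<le> 2"
    unfolding abs_le_iff using 1 bu by linarith
  then have "\<bar>q - \<tau>\<bar> \<le> 2 / F"
    using F0 by (simp add: eq divide_right_mono del: of_int_add of_int_mult)
  then show ?thesis
    using that factorial_cantor_extend[OF t mn c d(1,2) k q_def[unfolded F_def]]
    by (simp add: F_def)
qed

text \<open>All digits after position \<open>m\<close> are zero, and zero is not maximal there
  because \<open>m > 0\<close> gives \<open>i \<ge> 2\<close>. Such points supply elements of the
  set in a prescribed interval.\<close>

lemma rational_in_factorial_cantor:
  assumes "m > 0" shows "of_int k / fact m \<in> factorial_cantor m"
proof -
  have "\<lfloor>of_int k / fact m * fact i :: real\<rfloor> mod int i \<noteq> int i - 1" if "i > m" for i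
  proof -
    obtain l where l: "i = Suc l" "m \<le> l" using \<open>i > m\<close> by (cases i) auto
    obtain w :: int where w: "fact l = fact m * w"
      using fact_dvd[OF l(2), where 'a = int] by (auto elim: dvdE)
    have "of_int k / fact m * fact i = (of_int k / fact m * of_int (fact l) * i :: real)"
      using l by simp
    also have "\<dots> = of_int (k * w * int i)" unfolding w by simp
    finally have "\<lfloor>of_int k / fact m * fact i :: real\<rfloor> = k * w * int i" by (metis floor_of_int)
    then show ?thesis using l assms by simp
  qed
  then show ?thesis by (simp add: factorial_cantor_def)
qed

lemma same_cell_dist:
  fixes s t :: real
  assumes "\<lfloor>s * fact n\<rfloor> = \<lfloor>t * fact n\<rfloor>"
  shows "\<bar>s - t\<bar> < 1 / fact n"
proof -
  have "\<bar>s * fact n - t * fact n\<bar> < 1" using assms by linarith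
  then have "\<bar>s - t\<bar> * fact n < 1" by (simp add: abs_mult flip: left_diff_distrib)
  then show ?thesis by (simp add: field_simps)
qed

lemma inverse_fact_less:
  assumes "e > (0::real)"
  obtains M where "\<And>n. n \<ge> M \<Longrightarrow> 1 / fact n < e"
proof -
  obtain M where M: "M > 0" "1 / real M < e" using assms
    by (metis gr0I inverse_eq_divide real_arch_inverse)
  have "1 / fact n < e" if "n \<ge> M" for n
  proof -
    have "real M \<le> fact n" using that fact_ge_self[of n] by (metis le_trans of_nat_fact of_nat_le_iff)
    then have "1 / fact n \<le> 1 / real M" using M by (simp add: frac_le)
    then show ?thesis using M by simp
  qed
  then show ?thesis using that by blast
qed

text \<open>Two targets in the cell of \<open>t\<close> at distance \<open>5 / F\<close>, each
  approximated within \<open>2 / F\<close>, yield two different points of the set. Both share the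
  cell of \<open>t\<close>, and at least one differs from \<open>t\<close>.\<close>

lemma factorial_cantor_no_isolated:
  assumes t: "t \<in> factorial_cantor m" and "e > 0"
  obtains q where "q \<in> factorial_cantor m" "q \<noteq> t" "\<bar>q - t\<bar> < e"
proof -
  obtain M where M: "\<And>n. n \<ge> M \<Longrightarrow> 1 / fact n < e" using inverse_fact_less[OF \<open>e > 0\<close>] by blast
  define n where "n = max M (max m 3)"
  have n: "n \<ge> M" "n \<ge> m" "n \<ge> 3" by (auto simp: n_def)
  define k where "k = \<lfloor>t * fact n\<rfloor>"
  define \<tau> :: real where "\<tau> = of_int k / fact n"
  define F :: real where "F = fact (n + 2)"
  have F0: "F > 0" by (simp add: F_def del: fact_Suc)
  have nF: "n / fact (n + 1) = n * (n + 2) / F"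
    by (simp add: F_def divide_simps) (simp add: algebra_simps)
  \<comment> \<open>\<open>n \<ge> 3\<close> leaves room for the second target, \<open>5 / F\<close>
    past the left end of the cell, before the removed subcell.\<close>
  have "n * (n + 2) \<ge> 3 * 5" using n(3) by (intro mult_mono) auto
  then have "real (n * (n + 2)) \<ge> real (3 * 5)" by (rule of_nat_mono)
  then have 5: "5 / F < n / fact (n + 1)" unfolding nF using F0 by (intro divide_strict_right_mono) auto
  obtain q where q: "q \<in> factorial_cantor m" "\<lfloor>q * fact n\<rfloor> = k" "\<bar>q - \<tau>\<bar> \<le> 2 / F"
    using factorial_cantor_approx[OF t n(2) k_def, of \<tau>] n(3) unfolding F_def
    by (auto simp: \<tau>_def simp del: fact_Suc)
  obtain q' where q': "q' \<in> factorial_cantor m" "\<lfloor>q' * fact n\<rfloor> = k" "\<bar>q' - (\<tau> + 5 / F)\<bar> \<le> 2 / F"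
    using factorial_cantor_approx[OF t n(2) k_def, of "\<tau> + 5 / F"] 5 F0 unfolding F_def
    by (auto simp: \<tau>_def simp del: fact_Suc)
  have "q \<noteq> q'"
  proof
    assume "q = q'"
    then have "5 / F \<le> 2 / F + 2 / F" using q(3) q'(3) by linarith
    then show False using F0 by (simp add: divide_simps)
  qed
  then consider "q \<noteq> t" | "q' \<noteq> t" by blast
  then show ?thesis
    using that q q' same_cell_dist[of q n t] same_cell_dist[of q' n t] M[OF n(1)]
    by (smt (verit) k_def)
qed

section \<open>Measure zero of the closure\<close>

text \<open>Each surviving cell of stage \<open>n\<close> keeps at most \<open>n\<close> of its
  \<open>n + 1\<close> subcells, so the surviving proportion telescopes to
  \<open>m / (m + j)\<close>. The bound is multiplied out to stay within the natural
  numbers.\<close>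

lemma fact_cell_count:
  assumes "m > 0"
  shows "finite {\<lfloor>t * fact (m + j)\<rfloor> | t. t \<in> factorial_cantor m \<inter> {0..<real P}} \<and>
    card {\<lfloor>t * fact (m + j)\<rfloor> | t. t \<in> factorial_cantor m \<inter> {0..<real P}} * (m + j)
      \<le> P * m * fact (m + j)"
proof (induction j)
  case 0
  let ?A = "{\<lfloor>t * fact m\<rfloor> | t. t \<in> factorial_cantor m \<inter> {0..<real P}}"
  define N where "N = P * fact m"
  have "?A \<subseteq> {0..<int N}"
  proof clarsimp
    fix t assume "t \<ge> 0" "t < real P"
    then show "\<lfloor>t * fact m\<rfloor> < int N"
      by (simp add: floor_less_iff N_def)
  qed
  then have "finite ?A" "card ?A \<le> N"
    using card_mono[of "{0..<int N}" ?A] finite_subset[of ?A "{0..<int N}"] by simp_all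
  then show ?case by (simp add: N_def algebra_simps)
next
  case (Suc j)
  let ?A = "\<lambda>n. {\<lfloor>t * fact n\<rfloor> | t. t \<in> factorial_cantor m \<inter> {0..<real P}}"
  let ?n = "m + j"
  let ?f = "\<lambda>(k, c). k * (int ?n + 1) + c"
  have sub: "?A (Suc ?n) \<subseteq> ?f ` (?A ?n \<times> {0..<int ?n})"
  proof
    fix x assume "x \<in> ?A (Suc ?n)"
    then obtain t where t: "x = \<lfloor>t * fact (Suc ?n)\<rfloor>" "t \<in> factorial_cantor m" "t \<in> {0..<real P}"
      by auto
    let ?c = "x mod (int ?n + 1)"
    have "x = ?f (\<lfloor>t * fact ?n\<rfloor>, ?c)"
      unfolding floor_fact_Suc_div[of t ?n] t(1)[symmetric] by (simp only: prod.case div_mult_mod_eq)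
    moreover have "?c \<noteq> int ?n"
      using t(2) unfolding factorial_cantor_def t(1)
      by (auto simp del: fact_Suc dest!: spec[of _ "Suc ?n"] simp: add_ac)
    then have "?c \<in> {0..<int ?n}"
      using pos_mod_bound[of "int ?n + 1" x] pos_mod_sign[of "int ?n + 1" x] by simp
    ultimately show "x \<in> ?f ` (?A ?n \<times> {0..<int ?n})" using t(2,3) by blast
  qed
  have fin: "finite (?A ?n \<times> {0..<int ?n})" using Suc by auto
  then have fin': "finite (?A (Suc ?n))" using sub finite_subset by blast
  have "card (?A (Suc ?n)) \<le> card (?A ?n \<times> {0..<int ?n})"
    using surj_card_le[OF fin sub] .
  also have "\<dots> = card (?A ?n) * ?n" by (simp add: card_cartesian_product flip: of_nat_add)
  finally have "card (?A (Suc ?n)) * Suc ?n \<le> card (?A ?n) * ?n * Suc ?n"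
    by (metis (no_types, lifting) mult.commute mult.left_commute mult_le_mono1)
  also have "\<dots> \<le> P * m * fact ?n * Suc ?n"
    using Suc by (intro mult_le_mono1) auto
  finally show ?case using fin' by (simp add: algebra_simps)
qed

text \<open>A finite union of closed cells that covers the set also covers its closure. Its total
  length is at most \<open>P * m / (m + j)\<close>, which tends to 0 as \<open>j\<close>
  grows.\<close>

lemma null_closure_factorial_cantor:
  assumes "m > 0" "0 \<le> a"
  shows "emeasure lborel (closure (factorial_cantor m \<inter> {a..b})) = 0"
proof -
  let ?T = "factorial_cantor m \<inter> {a..b}"
  have main: "emeasure lborel (closure ?T) \<le> ennreal e" if e: "e > 0" for e :: real
  proof -
    obtain P :: nat where P: "b < real P" using reals_Archimedean2 by blast
    obtain j :: nat where j: "real P * real m / e < real j" using reals_Archimedean2 by blast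
    let ?n = "m + j"
    let ?A = "{\<lfloor>t * fact ?n\<rfloor> | t. t \<in> factorial_cantor m \<inter> {0..<real P}}"
    define cell :: "int \<Rightarrow> real set" where "cell = (\<lambda>k. {of_int k / fact ?n..(of_int k + 1) / fact ?n})"
    note count = fact_cell_count[OF assms(1), of j P]
    have "?T \<subseteq> (\<Union>k\<in>?A. cell k)"
    proof
      fix t assume t: "t \<in> ?T"
      then have "t \<in> cell \<lfloor>t * fact ?n\<rfloor>"
        by (auto simp: cell_def field_simps) linarith
      moreover have "\<lfloor>t * fact ?n\<rfloor> \<in> ?A" using t assms P by auto
      ultimately show "t \<in> (\<Union>k\<in>?A. cell k)" by blast
    qed
    moreover have "closed (\<Union>k\<in>?A. cell k)"
      using count by (intro closed_UN) (auto simp: cell_def)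
    ultimately have sub: "closure ?T \<subseteq> (\<Union>k\<in>?A. cell k)"
      by (rule closure_minimal)
    have "emeasure lborel (closure ?T) \<le> emeasure lborel (\<Union>k\<in>?A. cell k)"
      using \<open>closed (\<Union>k\<in>?A. cell k)\<close> by (intro emeasure_mono sub) auto
    also have "\<dots> \<le> (\<Sum>k\<in>?A. emeasure lborel (cell k))"
      using count by (intro emeasure_subadditive_finite) (auto simp: cell_def)
    also have "\<dots> = (\<Sum>k\<in>?A. ennreal (1 / fact ?n))"
      by (intro sum.cong refl) (simp add: cell_def divide_right_mono flip: diff_divide_distrib)
    also have "\<dots> = ennreal (card ?A / fact ?n)"
      by (simp add: ennreal_of_nat_eq_real_of_nat flip: ennreal_mult)
    also have "\<dots> \<le> ennreal e"
    proof (rule ennreal_leI)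
      have "real (card ?A) * real ?n \<le> real P * real m * fact ?n"
        using count of_nat_mono[of "card ?A * ?n" "P * m * fact ?n", where 'a = real]
        by (simp only: of_nat_mult of_nat_fact)
      then have "real (card ?A) / fact ?n \<le> real P * real m / real ?n"
        using assms by (simp add: divide_simps)
      also have "\<dots> \<le> e"
        using j e assms by (simp add: divide_simps algebra_simps) (smt (verit) mult_nonneg_nonneg of_nat_0_le_iff)
      finally show "real (card ?A) / fact ?n \<le> e" .
    qed
    finally show ?thesis .
  qed
  have "emeasure lborel (closure ?T) \<le> 0"
    by (rule ennreal_le_epsilon) (use main in simp)
  then show ?thesis by simp
qed

section \<open>Uncountability of the Cantor set\<close>

text \<open>The closure is nonempty and perfect, hence uncountable, and beyond the set itself it
  contains at most the two endpoints and rational points.\<close>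

lemma uncountable_factorial_cantor:
  assumes ne: "factorial_cantor m \<inter> {a<..<b} \<noteq> {}"
  shows "uncountable (factorial_cantor m \<inter> {a<..<b})"
proof
  let ?T = "factorial_cantor m \<inter> {a<..<b}"
  let ?C = "closure ?T"
  assume count: "countable ?T"
  have lim: "t islimpt ?T" if "t \<in> ?T" for t
    unfolding islimpt_approachable
  proof (intro allI impI)
    fix e :: real assume "e > 0"
    have t: "t \<in> factorial_cantor m" and "min e (min (t - a) (b - t)) > 0"
      using that \<open>e > 0\<close> by auto
    then obtain q where "q \<in> factorial_cantor m" "q \<noteq> t" "\<bar>q - t\<bar> < min e (min (t - a) (b - t))"
      by (rule factorial_cantor_no_isolated)
    then show "\<exists>x'\<in>?T. x' \<noteq> t \<and> dist x' t < e"
      by (intro bexI[of _ q]) (auto simp: dist_real_def)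
  qed
  have "euclidean derived_set_of ?C = {t. t islimpt ?C}"
    by (auto simp: derived_set_of_def islimpt_def)
  also have "\<dots> = ?C"
    unfolding limpt_of_closure using lim by (auto simp: closure_def)
  finally have "euclidean derived_set_of ?C = ?C" .
  moreover have "?C \<noteq> {}" using ne by simp
  ultimately have "(UNIV :: real set) \<lesssim> ?C"
    by (intro lepoll_perfect_set[of euclidean] disjI1 completely_metrizable_space_euclidean)
  then have "uncountable ?C"
    using uncountable_UNIV_real countable_lepoll by blast
  moreover have "?C \<subseteq> ?T \<union> ({a, b} \<union> \<rat>)"
  proof
    fix t assume t: "t \<in> ?C"
    have "?C \<subseteq> {a..b}" by (intro closure_minimal) auto
    then have tab: "t \<in> {a..b}" using t by blast
    have "t \<in> factorial_cantor m" if "t \<notin> \<rat>"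
    proof (rule ccontr)
      assume "t \<notin> factorial_cantor m"
      then obtain i where i: "i > m" "\<lfloor>t * fact i\<rfloor> mod int i = int i - 1"
        by (auto simp: factorial_cantor_def)
      define l where "l = \<lfloor>t * fact i\<rfloor>"
      \<comment> \<open>Irrationality puts \<open>t\<close> in the interior of its removed cell;
        points of \<open>?T\<close> close to \<open>t\<close> would then have the same maximal digit
        at position \<open>i\<close>.\<close>
      have "t * fact i \<noteq> of_int l"
      proof
        assume "t * fact i = of_int l"
        then have "t = of_int l / of_int (fact i)" by (simp add: field_simps)
        then have "t \<in> \<rat>" by (metis Rats_divide Rats_of_int)
        then show False using that by simp
      qed
      then have tl: "of_int l < t * fact i" "t * fact i < of_int l + 1"
        unfolding l_def by linarith+
      let ?U = "{of_int l / fact i<..<(of_int l + 1) / fact i} :: real set"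
      have "t \<in> ?U" using tl by (simp add: field_simps)
      then have "?U \<inter> ?C \<noteq> {}" using t by blast
      then have "?U \<inter> ?T \<noteq> {}" by (simp add: open_Int_closure_eq_empty)
      then obtain x where x: "x \<in> ?T" "x \<in> ?U" by blast
      then have "of_int l < x * fact i" "x * fact i < of_int l + 1"
        by (simp_all add: field_simps)
      then have "\<lfloor>x * fact i\<rfloor> = l" by linarith
      then show False using x(1) i unfolding l_def factorial_cantor_def by auto
    qed
    then show "t \<in> ?T \<union> ({a, b} \<union> \<rat>)" using tab by force
  qed
  ultimately show False
    using count countable_rat by (meson countable_Un countable_finite countable_subset finite.intros)
qed

section \<open>Segments of irrational slope meet the lattice neighbourhood\<close>

text \<open>Dirichlet approximation provides a multiple of \<alpha> that differs from an integer by
  some nonzero \<eta> with \<open>\<bar>\<eta>\<bar> < \<delta>\<close>. Steps of size \<eta> come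
  within \<delta> of an integer after at most \<open>1 / \<bar>\<eta>\<bar>\<close> of them,
  whatever the starting point \<open>y\<close>.\<close>

lemma irrational_rotation_uniform:
  fixes \<alpha> \<delta> :: real
  assumes "\<alpha> \<notin> \<rat>" "\<delta> > 0"
  obtains J :: nat where "\<And>y :: real. \<exists>j\<le>J. \<exists>l::int. \<bar>y + real j * \<alpha> - of_int l\<bar> < \<delta>"
proof -
  obtain N :: nat where N: "N > 0" "1 / real N < \<delta>"
    using assms(2) by (metis gr0I inverse_eq_divide real_arch_inverse)
  obtain h k where k: "0 < k" "\<bar>of_int k * \<alpha> - of_int h\<bar> < 1 / N"
    using Dirichlet_approx[OF N(1)] by metis
  define \<eta> where "\<eta> = of_int k * \<alpha> - of_int h"
  have "\<eta> \<noteq> 0"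
  proof
    assume "\<eta> = 0"
    then have "\<alpha> = of_int h / of_int k" using k(1) by (simp add: \<eta>_def field_simps)
    then show False using assms(1) by simp
  qed
  have \<eta>: "\<bar>\<eta>\<bar> < \<delta>" using k N by (simp add: \<eta>_def)
  define M where "M = nat \<lfloor>1 / \<bar>\<eta>\<bar>\<rfloor>"
  have "\<exists>j\<le>nat k * M. \<exists>l::int. \<bar>y + real j * \<alpha> - of_int l\<bar> < \<delta>" for y
  proof -
    \<comment> \<open>The target integer lies on the side of \<open>y\<close> towards which steps by
      \<eta> move, and \<open>w\<close> is the distance to be covered.\<close>
    define l where "l = (if \<eta> > 0 then \<lceil>y\<rceil> else \<lfloor>y\<rfloor>)"
    define w where "w = \<bar>of_int l - y\<bar>"
    have w: "0 \<le> w" "w < 1" unfolding w_def l_def by (auto; linarith)+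
    have sg: "y - of_int l = - sgn \<eta> * w"
      using \<open>\<eta> \<noteq> 0\<close> unfolding w_def l_def by (auto simp: sgn_if; linarith)
    define i where "i = nat \<lfloor>w / \<bar>\<eta>\<bar>\<rfloor>"
    have ri: "real i = of_int \<lfloor>w / \<bar>\<eta>\<bar>\<rfloor>" using w by (simp add: i_def)
    have "w / \<bar>\<eta>\<bar> \<le> 1 / \<bar>\<eta>\<bar>" using w by (simp add: divide_right_mono)
    then have "i \<le> M" unfolding i_def M_def by (intro nat_mono floor_mono)
    have "real i \<le> w / \<bar>\<eta>\<bar>" "w / \<bar>\<eta>\<bar> < real i + 1" unfolding ri by linarith+
    then have "real i * \<bar>\<eta>\<bar> \<le> w" "w < real i * \<bar>\<eta>\<bar> + \<bar>\<eta>\<bar>"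
      using \<open>\<eta> \<noteq> 0\<close> by (simp_all add: field_simps)
    then have close: "\<bar>real i * \<bar>\<eta>\<bar> - w\<bar> < \<delta>" using \<eta> by linarith
    have eq1: "y + real (nat k * i) * \<alpha> - of_int (l + int i * h) = (y - of_int l) + real i * \<eta>"
      using k(1) by (simp add: \<eta>_def algebra_simps)
    have eq2: "(y - of_int l) + real i * \<eta> = sgn \<eta> * (real i * \<bar>\<eta>\<bar> - w)"
      unfolding sg using \<open>\<eta> \<noteq> 0\<close> by (cases "\<eta> > 0") (auto simp: sgn_if)
    have "\<bar>sgn \<eta>\<bar> = 1" using \<open>\<eta> \<noteq> 0\<close> by (simp add: abs_sgn_eq)
    then have "\<bar>y + real (nat k * i) * \<alpha> - of_int (l + int i * h)\<bar> < \<delta>"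
      unfolding eq1 eq2 abs_mult using close by simp
    then show ?thesis using \<open>i \<le> M\<close> by (meson mult_le_mono2)
  qed
  then show ?thesis using that by blast
qed

text \<open>Cramer's rule: \<open>Im (cnj e1 * e2)\<close> is the determinant of the pair, and its
  being nonzero expresses real linear independence.\<close>

lemma complex_basis_coords:
  assumes "Im (cnj e1 * e2) \<noteq> 0"
  obtains x y :: real where "w = x *\<^sub>R e1 + y *\<^sub>R e2"
proof
  define D where "D = Re e1 * Im e2 - Im e1 * Re e2"
  have D: "D \<noteq> 0" using assms by (simp add: D_def)
  show "w = ((Re w * Im e2 - Im w * Re e2) / D) *\<^sub>R e1 + ((Re e1 * Im w - Im e1 * Re w) / D) *\<^sub>R e2"
    using D by (auto simp: complex_eq_iff divide_simps) (auto simp: D_def algebra_simps)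
qed

text \<open>Quantifying over every starting point \<open>p\<close> leaves a property of the
  direction and the length alone, so the segment can be placed later.\<close>

definition hits_lattice :: "complex \<Rightarrow> complex \<Rightarrow> real \<Rightarrow> complex \<Rightarrow> real \<Rightarrow> bool" where
  "hits_lattice e1 e2 \<epsilon> v L \<longleftrightarrow>
     (\<forall>p. \<exists>s\<in>{0..L}. \<exists>m n::int. norm (p + s *\<^sub>R v - (of_int m * e1 + of_int n * e2)) < \<epsilon>)"

text \<open>The line crosses the parallels to \<open>e2\<close> with integer
  \<open>e1\<close>-coordinate at regular times, and between crossings its
  \<open>e2\<close>-coordinate advances by \<open>b / a\<close>. This is an irrational rotation, so
  some early crossing is close to a lattice point.\<close>

lemma hits_lattice_irrational_pos:
  assumes ind: "Im (cnj e1 * e2) \<noteq> 0" and "\<epsilon> > 0"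
    and v: "v = a *\<^sub>R e1 + b *\<^sub>R e2" and "a > 0" "b / a \<notin> \<rat>"
  shows "\<exists>L\<ge>0. hits_lattice e1 e2 \<epsilon> v L"
proof -
  have "e2 \<noteq> 0" using ind by auto
  define \<alpha> where "\<alpha> = b / a"
  have "\<epsilon> / norm e2 > 0" using \<open>\<epsilon> > 0\<close> \<open>e2 \<noteq> 0\<close> by simp
  then obtain J where J: "\<And>y :: real. \<exists>j\<le>J. \<exists>l::int. \<bar>y + real j * \<alpha> - of_int l\<bar> < \<epsilon> / norm e2"
    using irrational_rotation_uniform[of \<alpha> "\<epsilon> / norm e2"] assms(5) unfolding \<alpha>_def by blast
  have "\<exists>s\<in>{0..(J + 1) / a}. \<exists>m n::int. norm (p + s *\<^sub>R v - (of_int m * e1 + of_int n * e2)) < \<epsilon>" for p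
  proof -
    obtain x y where p: "p = x *\<^sub>R e1 + y *\<^sub>R e2" using complex_basis_coords[OF ind] .
    define x0 where "x0 = of_int \<lceil>x\<rceil> - x"
    have x0: "0 \<le> x0" "x0 < 1" unfolding x0_def by linarith+
    obtain j l where j: "j \<le> J" "\<bar>(y + x0 * \<alpha>) + real j * \<alpha> - of_int l\<bar> < \<epsilon> / norm e2"
      using J by blast
    \<comment> \<open>The time at which the \<open>e1\<close>-coordinate reaches the integer
      \<open>\<lceil>x\<rceil> + j\<close>.\<close>
    define s where "s = (j + x0) / a"
    have s: "s \<in> {0..(J + 1) / a}"
      using x0 j(1) \<open>a > 0\<close> by (auto simp: s_def intro!: divide_right_mono)
    have sa: "s * a = j + x0" "s * b = (j + x0) * \<alpha>"
      using \<open>a > 0\<close> by (simp_all add: s_def \<alpha>_def)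
    have "p + s *\<^sub>R v = (x + s * a) *\<^sub>R e1 + (y + s * b) *\<^sub>R e2"
      by (simp add: p v algebra_simps)
    also have "\<dots> = of_int (\<lceil>x\<rceil> + int j) * e1 + (y + (j + x0) * \<alpha>) *\<^sub>R e2"
      unfolding sa by (simp add: x0_def scaleR_conv_of_real)
    finally have "p + s *\<^sub>R v - (of_int (\<lceil>x\<rceil> + int j) * e1 + of_int l * e2)
      = ((y + x0 * \<alpha>) + real j * \<alpha> - of_int l) *\<^sub>R e2"
      by (simp add: scaleR_conv_of_real algebra_simps)
    then have "norm (p + s *\<^sub>R v - (of_int (\<lceil>x\<rceil> + int j) * e1 + of_int l * e2)) < \<epsilon>"
      using j(2) \<open>e2 \<noteq> 0\<close> by (simp add: pos_less_divide_eq del: of_int_add)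
    then show ?thesis using s by blast
  qed
  then show ?thesis unfolding hits_lattice_def using \<open>a > 0\<close>
    by (intro exI[of _ "(J + 1) / a"]) auto
qed

text \<open>Negating \<open>m\<close> shows that \<open>- e1\<close> and \<open>e2\<close> span the
  same lattice; this reduces a negative coefficient \<open>a\<close> to a positive one.\<close>

lemma hits_lattice_uminus: "hits_lattice (- e1) e2 \<epsilon> v L \<Longrightarrow> hits_lattice e1 e2 \<epsilon> v L"
  unfolding hits_lattice_def mult_minus_right mult_minus_left[symmetric] of_int_minus[symmetric]
  by blast

lemma hits_lattice_irrational:
  assumes ind: "Im (cnj e1 * e2) \<noteq> 0" and "\<epsilon> > 0"
    and v: "v = a *\<^sub>R e1 + b *\<^sub>R e2" and "a \<noteq> 0" "b / a \<notin> \<rat>"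
  shows "\<exists>L\<ge>0. hits_lattice e1 e2 \<epsilon> v L"
proof (cases "a > 0")
  case True
  then show ?thesis using hits_lattice_irrational_pos assms by blast
next
  case False
  have "b / - a \<notin> \<rat>" using assms(5) by (simp add: Rats_minus_iff)
  then show ?thesis
    using hits_lattice_irrational_pos[of "- e1" e2 \<epsilon> v "- a" b] assms False hits_lattice_uminus by auto
qed

section \<open>Irrational directions and uniformity over all directions\<close>

text \<open>\<open>Im (cnj (cis x) * w) = 0\<close> says that \<open>w\<close> lies on the real line
  through \<open>cis x\<close>, and the angle of a line is determined modulo
  \<open>pi\<close>.\<close>

lemma orthogonal_angle_unique:
  assumes "w \<noteq> 0" "Im (cnj (cis x) * w) = 0" "Im (cnj (cis y) * w) = 0" "\<bar>x - y\<bar> < pi"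
  shows "x = y"
proof -
  have x: "cos x * Im w = sin x * Re w" and y: "cos y * Im w = sin y * Re w"
    using assms by (simp_all add: algebra_simps)
  have "sin (x - y) * Re w = (sin x * Re w) * cos y - cos x * (sin y * Re w)"
    by (simp add: sin_diff algebra_simps)
  also have "\<dots> = 0" by (simp flip: x y)
  finally have 1: "sin (x - y) * Re w = 0" .
  have "sin (x - y) * Im w = sin x * (cos y * Im w) - (cos x * Im w) * sin y"
    by (simp add: sin_diff algebra_simps)
  also have "\<dots> = 0" by (simp add: x y)
  finally have "sin (x - y) = 0" using 1 assms(1) by (auto simp: complex_eq_iff)
  then show ?thesis using assms(4) sin_eq_0_pi[of "x - y"] by auto
qed

text \<open>A direction whose slope with respect to \<open>e1, e2\<close> is rational is parallel to a lattice vector,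
  so only countably many angles are bad, whereas \<open>K\<close> is uncountable.\<close>

lemma exists_irrational_direction:
  assumes ind: "Im (cnj e1 * e2) \<noteq> 0" and "\<epsilon> > 0"
    and K: "uncountable K" "K \<subseteq> {c..d}" "d - c < pi"
  shows "\<exists>\<theta>\<in>K. \<exists>L\<ge>0. hits_lattice e1 e2 \<epsilon> (cis (\<phi> - \<theta>)) L"
proof (rule ccontr)
  assume neg: "\<not> ?thesis"
  define w where "w = (\<lambda>(p, q). of_int p * e1 + of_int q * e2)"
  have w0: "w pq \<noteq> 0" if "pq \<noteq> (0, 0)" for pq :: "int \<times> int"
  proof
    obtain p q where pq: "pq = (p, q)" by fastforce
    assume "w pq = 0"
    then have eq: "of_int p * e1 + of_int q * e2 = 0" by (simp add: w_def pq)
    \<comment> \<open>Cross products with \<open>e1\<close> and \<open>e2\<close> recover both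
      coefficients up to the nonzero determinant.\<close>
    have "of_int q * Im (cnj e1 * e2) = Im (cnj e1 * (of_int p * e1 + of_int q * e2))"
      "of_int p * Im (cnj e1 * e2) = - Im (cnj e2 * (of_int p * e1 + of_int q * e2))"
      by (simp_all add: algebra_simps)
    then show False using that ind unfolding eq pq by auto
  qed
  have "\<exists>pq. pq \<noteq> (0, 0) \<and> Im (cnj (cis (\<phi> - \<theta>)) * w pq) = 0" if "\<theta> \<in> K" for \<theta>
  proof -
    obtain a b where v: "cis (\<phi> - \<theta>) = a *\<^sub>R e1 + b *\<^sub>R e2" using complex_basis_coords[OF ind] .
    have "a = 0 \<or> b / a \<in> \<rat>"
      using hits_lattice_irrational[OF ind \<open>\<epsilon> > 0\<close> v] neg that by blast
    then show ?thesis
    proof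
      assume "a = 0"
      then show ?thesis unfolding v by (intro exI[of _ "(0, 1)"]) (simp add: w_def)
    next
      assume "b / a \<in> \<rat>"
      then obtain p q where pq: "q > 0" "b / a = of_int p / of_int q" by (meson Rats_cases')
      show ?thesis
      proof (cases "a = 0")
        case True
        then show ?thesis unfolding v by (intro exI[of _ "(0, 1)"]) (simp add: w_def)
      next
        case False
        then have "b * of_int q = a * of_int p" using pq by (simp add: field_simps)
        then have "of_int q *\<^sub>R cis (\<phi> - \<theta>) = a *\<^sub>R w (q, p)"
          unfolding v by (simp add: w_def complex_eq_iff algebra_simps)
        then have "of_int q * Im (cnj (cis (\<phi> - \<theta>)) * w (q, p)) = Im (cnj (a *\<^sub>R w (q, p)) * w (q, p))"
          by (metis (no_types, lifting) complex_cnj_scaleR mult_scaleR_left scaleR_complex.simps(2))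
        also have "\<dots> = 0" by (simp add: algebra_simps)
        finally have "Im (cnj (cis (\<phi> - \<theta>)) * w (q, p)) = 0" using pq(1) by simp
        then show ?thesis using pq(1) by (intro exI[of _ "(q, p)"]) auto
      qed
    qed
  qed
  then obtain f where f: "\<And>\<theta>. \<theta> \<in> K \<Longrightarrow> f \<theta> \<noteq> (0, 0) \<and> Im (cnj (cis (\<phi> - \<theta>)) * w (f \<theta>)) = 0"
    by metis
  \<comment> \<open>\<open>K\<close> lies in an interval shorter than \<open>pi\<close>, so a
    nonzero lattice vector is parallel to at most one of its directions. Thus \<open>f\<close> would
    embed \<open>K\<close> into a countable set.\<close>
  have "inj_on f K"
  proof (rule inj_onI)
    fix x y assume xy: "x \<in> K" "y \<in> K" "f x = f y"
    have xy_lt: "\<bar>(\<phi> - x) - (\<phi> - y)\<bar> < pi" using subsetD[OF K(2) xy(1)] subsetD[OF K(2) xy(2)] K(3) by auto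
    have w_xy: "w (f x) \<noteq> 0" "Im (cnj (cis (\<phi> - x)) * w (f x)) = 0" "Im (cnj (cis (\<phi> - y)) * w (f x)) = 0"
      using f[OF xy(1)] f[OF xy(2)] w0[of "f x"] unfolding xy(3) by blast+
    have "\<phi> - x = \<phi> - y"
      using w_xy xy_lt by (rule orthogonal_angle_unique)
    then show "x = y" by simp
  qed
  then show False using K(1) countable_image_inj_on[of f K] countableI_type by blast
qed

lemma norm_cis_diff_le: "norm (cis x - cis y) \<le> \<bar>x - y\<bar>"
proof -
  have "cis x - cis y = cis y * (exp (\<i> * of_real (x - y)) - 1)"
    by (simp add: cis_conv_exp algebra_simps flip: exp_add)
  then have "norm (cis x - cis y) = norm (exp (\<i> * of_real (x - y)) - 1)"
    by (simp add: norm_mult)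
  also have "\<dots> \<le> \<bar>x - y\<bar>"
    using Taylor_exp[of "\<i> * of_real (x - y)" 0] by (simp add: norm_mult del: of_real_diff)
  finally show ?thesis .
qed

text \<open>Second-order Taylor remainder; it controls the departure of a circular arc from its
  tangent.\<close>

lemma norm_cis_linear_le: "norm (cis h - 1 - \<i> * of_real h) \<le> h\<^sup>2"
  using Taylor_exp[of "\<i> * of_real h" 1] by (simp add: cis_conv_exp norm_mult power2_eq_square algebra_simps)

text \<open>Compactness in \<open>\<phi>\<close>: a good pair \<open>(\<theta>, L)\<close> for \<open>\<epsilon>/2\<close> remains good for \<open>\<epsilon>\<close> at nearby \<open>\<phi>\<close>.\<close>

lemma hits_lattice_uniform:
  assumes ind: "Im (cnj e1 * e2) \<noteq> 0" and "\<epsilon> > 0"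
    and K: "uncountable K" "K \<subseteq> {c..d}" "d - c < pi"
  obtains L where "L > 0" "\<And>\<phi>. \<exists>\<theta>\<in>K. hits_lattice e1 e2 \<epsilon> (cis (\<phi> - \<theta>)) L"
proof -
  have "\<forall>\<phi>. \<exists>\<theta> L. \<theta> \<in> K \<and> L \<ge> 0 \<and> hits_lattice e1 e2 (\<epsilon> / 2) (cis (\<phi> - \<theta>)) L"
    using exists_irrational_direction[OF ind _ K, of "\<epsilon> / 2"] \<open>\<epsilon> > 0\<close> by (simp add: Bex_def)
  then obtain \<theta> L where \<theta>: "\<And>\<phi>. \<theta> \<phi> \<in> K" and L: "\<And>\<phi>. L \<phi> \<ge> 0"
    and hit: "\<And>\<phi>. hits_lattice e1 e2 (\<epsilon> / 2) (cis (\<phi> - \<theta> \<phi>)) (L \<phi>)"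
    by metis
  \<comment> \<open>Turning a segment of length \<open>L \<phi>\<close> by less than
    \<open>\<rho> \<phi>\<close> moves its points by at most \<open>\<epsilon> / 2\<close>; the
    summand 1 avoids division by zero.\<close>
  define \<rho> where "\<rho> = (\<lambda>\<phi>. \<epsilon> / (2 * (L \<phi> + 1)))"
  have \<rho>: "\<rho> \<phi> > 0" for \<phi> using L[of \<phi>] \<open>\<epsilon> > 0\<close> by (simp add: \<rho>_def)
  obtain C where C: "C \<subseteq> {0..2 * pi}" "finite C" "{0..2 * pi} \<subseteq> (\<Union>\<phi>\<in>C. ball \<phi> (\<rho> \<phi>))"
    by (rule compactE_image[of "{0..2 * pi}" "{0..2 * pi}" "\<lambda>\<phi>. ball \<phi> (\<rho> \<phi>)"])
       (use \<rho> in \<open>auto intro: centre_in_ball[THEN iffD2]\<close>)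
  \<comment> \<open>As every \<open>L \<phi>\<close> is nonnegative, the sum over the finite
    subcover bounds each of them.\<close>
  define M where "M = sum L C + 1"
  have "M > 0" unfolding M_def using L by (simp add: add_nonneg_pos sum_nonneg)
  moreover have "\<exists>\<theta>\<in>K. hits_lattice e1 e2 \<epsilon> (cis (\<psi> - \<theta>)) M" for \<psi>
  proof -
    define \<psi>' where "\<psi>' = \<psi> - 2 * pi * of_int \<lfloor>\<psi> / (2 * pi)\<rfloor>"
    have "of_int \<lfloor>\<psi> / (2 * pi)\<rfloor> * (2 * pi) \<le> \<psi>" "\<psi> \<le> (of_int \<lfloor>\<psi> / (2 * pi)\<rfloor> + 1) * (2 * pi)"
      using floor_divide_lower[of "2 * pi" \<psi>] floor_divide_upper[of "2 * pi" \<psi>] by simp_all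
    then have "\<psi>' \<in> {0..2 * pi}" by (simp add: \<psi>'_def algebra_simps)
    then obtain \<phi> where \<phi>: "\<phi> \<in> C" "dist \<phi> \<psi>' < \<rho> \<phi>" using C(3) by auto
    have cis: "cis (\<psi> - t) = cis (\<psi>' - t)" for t
    proof -
      have "cis (\<psi> - t) = cis (\<psi>' - t) * cis (2 * pi * of_int \<lfloor>\<psi> / (2 * pi)\<rfloor>)"
        unfolding cis_mult by (simp add: \<psi>'_def)
      then show ?thesis by simp
    qed
    have LM: "L \<phi> \<le> M"
      unfolding M_def using member_le_sum[OF \<phi>(1), of L] C(2) L by force
    have "hits_lattice e1 e2 \<epsilon> (cis (\<psi> - \<theta> \<phi>)) M"
      unfolding hits_lattice_def
    proof
      fix p
      obtain s m n where s: "s \<in> {0..L \<phi>}"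
        and smn: "norm (p + s *\<^sub>R cis (\<phi> - \<theta> \<phi>) - (of_int m * e1 + of_int n * e2)) < \<epsilon> / 2"
        using hit[of \<phi>] unfolding hits_lattice_def by blast
      have "norm (s *\<^sub>R cis (\<psi> - \<theta> \<phi>) - s *\<^sub>R cis (\<phi> - \<theta> \<phi>)) = s * norm (cis (\<psi>' - \<theta> \<phi>) - cis (\<phi> - \<theta> \<phi>))"
        using s by (simp add: cis flip: scaleR_diff_right)
      also have "\<dots> \<le> L \<phi> * \<bar>\<psi>' - \<phi>\<bar>"
        using s norm_cis_diff_le[of "\<psi>' - \<theta> \<phi>" "\<phi> - \<theta> \<phi>"] by (intro mult_mono) auto
      also have "\<dots> \<le> L \<phi> * \<rho> \<phi>"
        using \<phi>(2) L by (intro mult_left_mono) (auto simp: dist_real_def)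
      also have "\<dots> \<le> \<epsilon> / 2"
        using L[of \<phi>] \<open>\<epsilon> > 0\<close> by (simp add: \<rho>_def divide_simps)
      finally have "norm ((p + s *\<^sub>R cis (\<phi> - \<theta> \<phi>) - (of_int m * e1 + of_int n * e2)) +
          (s *\<^sub>R cis (\<psi> - \<theta> \<phi>) - s *\<^sub>R cis (\<phi> - \<theta> \<phi>))) < \<epsilon> / 2 + \<epsilon> / 2"
        by (rule order.strict_trans1[OF norm_triangle_ineq add_less_le_mono[OF smn]])
      then show "\<exists>s\<in>{0..M}. \<exists>m n. norm (p + s *\<^sub>R cis (\<psi> - \<theta> \<phi>) - (of_int m * e1 + of_int n * e2)) < \<epsilon>"
        using s LM by (intro bexI[of _ s] exI[of _ m] exI[of _ n]) (auto simp: algebra_simps)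
    qed
    then show ?thesis using \<theta> by blast
  qed
  ultimately show ?thesis using that by blast
qed

section \<open>Comparison of the rotated arc with a tangent segment\<close>

lemma factorial_bracket:
  fixes r c :: real
  assumes "c > 0" "c * fact M \<le> r"
  obtains n where "n \<ge> M" "c * fact n \<le> r" "r < c * fact (Suc n)"
proof -
  have mono: "c * fact i \<le> c * fact j" if "i \<le> j" for i j
    using that assms(1) by (intro mult_left_mono fact_mono) auto
  obtain N :: nat where N: "r / c < real N" using reals_Archimedean2 by blast
  have "real N \<le> fact N" by (metis fact_ge_self of_nat_fact of_nat_le_iff)
  then have "r / c < fact N" using N by linarith
  then have "r < c * fact N" using assms(1) by (simp add: field_simps)
  moreover have "\<not> r < c * fact 0" using mono[of 0 M] assms(2) by simp
  ultimately obtain n where n: "\<forall>i\<le>n. \<not> r < c * fact i" "r < c * fact (Suc n)"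
    using ex_least_nat_less[of "\<lambda>i. r < c * fact i" N] by blast
  have "n \<ge> M"
  proof (rule ccontr)
    assume "\<not> n \<ge> M"
    then show False using mono[of "Suc n" M] n(2) assms(2) by simp
  qed
  then show ?thesis using that n by (meson linorder_not_less order_refl)
qed

text \<open>Half of \<epsilon> is spent on the tangent segment meeting the lattice neighbourhood,
  half on replacing the segment by points of the arc. The angle \<theta> is taken from the inner
  interval, because the final angle \<open>q\<close> shares only a cell with it and may leave that
  interval.\<close>

lemma factorial_cantor_hits_lattice:
  assumes ind: "Im (cnj e1 * e2) \<noteq> 0" and "\<epsilon> > 0" and "m > 0"
    and cd: "c < c'" "d' < d" "d' - c' < pi"
    and ne: "factorial_cantor m \<inter> {c'<..<d'} \<noteq> {}"
  obtains R where "R > 0"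
    "\<And>z. norm z \<ge> R \<Longrightarrow> \<exists>q\<in>factorial_cantor m \<inter> {c..d}. \<exists>i j::int.
       norm (cis (- q) * z - (of_int i * e1 + of_int j * e2)) < \<epsilon>"
proof -
  let ?K = "factorial_cantor m \<inter> {c'<..<d'}"
  obtain L where L: "L > 0" "\<And>\<phi>. \<exists>\<theta>\<in>?K. hits_lattice e1 e2 (\<epsilon> / 2) (cis (\<phi> - \<theta>)) L"
    using hits_lattice_uniform[OF ind _ uncountable_factorial_cantor[OF ne] _ cd(3), of "\<epsilon> / 2"] \<open>\<epsilon> > 0\<close>
    by (metis (no_types, lifting) Int_iff greaterThanLessThan_subseteq_atLeastAtMost_iff half_gt_zero order_refl subsetI subset_iff)
  have "min (c' - c) (d - d') > 0" using cd by simp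
  then obtain M1 where M1: "\<And>n. n \<ge> M1 \<Longrightarrow> 1 / fact n < min (c' - c) (d - d')"
    by (rule inverse_fact_less) blast
  obtain M2 :: nat where M2: "16 * L / \<epsilon> < real M2" using reals_Archimedean2 by blast
  \<comment> \<open>\<open>M1\<close> keeps \<open>q\<close> inside \<open>{c..d}\<close>, and
    \<open>M2\<close> makes the final error \<open>8 * L / (n - 1)\<close> smaller than
    \<open>\<epsilon> / 2\<close>.\<close>
  define M where "M = Max {m, 3, M1, M2 + 1}"
  have M: "m \<le> M" "3 \<le> M" "M1 \<le> M" "M2 + 1 \<le> M" by (simp_all add: M_def)
  show ?thesis
  proof
    show "2 * L * fact M > 0" using L(1) by simp
  next
    fix z :: complex assume z: "norm z \<ge> 2 * L * fact M"
    define r where "r = norm z"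
    define \<phi> where "\<phi> = Arg z"
    have z_eq: "z = of_real r * cis \<phi>"
      using rcis_cmod_Arg[of z] by (simp add: rcis_def r_def \<phi>_def)
    have "2 * L > 0" "2 * L * fact M \<le> r" using L(1) z by (simp_all add: r_def)
    then obtain n where n: "n \<ge> M" "2 * L * fact n \<le> r" "r < 2 * L * fact (Suc n)"
      by (rule factorial_bracket)
    have "r > 0" using n(2) L(1) by (smt (verit) fact_gt_zero mult_pos_pos)
    \<comment> \<open>As \<open>t\<close> increases, \<open>cis (- t) * z\<close> moves clockwise,
      so its tangent direction at \<open>t = \<theta>\<close> has angle
      \<open>\<phi> - \<theta> - pi / 2\<close>.\<close>
    obtain \<theta> where \<theta>: "\<theta> \<in> ?K" "hits_lattice e1 e2 (\<epsilon> / 2) (cis (\<phi> - pi / 2 - \<theta>)) L"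
      using L(2) by blast
    define e where "e = cis (\<phi> - \<theta>)"
    have "cis (\<phi> - pi / 2 - \<theta>) = cis (- (pi / 2)) * e"
      unfolding e_def cis_mult by (simp add: algebra_simps)
    also have "cis (- (pi / 2)) = - \<i>" by (simp add: complex_eq_iff)
    finally have dir: "cis (\<phi> - pi / 2 - \<theta>) = - \<i> * e" .
    define k where "k = \<lfloor>\<theta> * fact n\<rfloor>"
    define t0 :: real where "t0 = of_int k / fact n"
    \<comment> \<open>The tangent at \<theta> is parametrised by \<open>t\<close> as
      \<open>r * e * (1 + \<i> * (\<theta> - t))\<close>; \<open>p\<close> is its point at the left
      end \<open>t0\<close> of the cell, and moving on by \<open>s\<close> leads to the parameter
      \<open>\<tau> = t0 + s / r\<close>.\<close>
    define p where "p = of_real r * e * (1 + \<i> * of_real (\<theta> - t0))"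
    obtain s i j where s: "s \<in> {0..L}"
      and hit: "norm (p + s *\<^sub>R (- \<i> * e) - (of_int i * e1 + of_int j * e2)) < \<epsilon> / 2"
      using \<theta>(2) unfolding hits_lattice_def dir by blast
    define \<tau> where "\<tau> = t0 + s / r"
    \<comment> \<open>The segment of length \<open>L\<close> spans at most half a cell, so \<tau>
      stays short of the removed last subcell.\<close>
    have "s / r \<le> L / (2 * L * fact n)" using s L(1) n(2) by (intro frac_le) auto
    also have "\<dots> = 1 / (2 * fact n)" using L(1) by simp
    also have "\<dots> = (1 / 2) / fact n" by simp
    also have "\<dots> < (n / (n + 1)) / fact n"
      using n(1) M(2) by (intro divide_strict_right_mono) (simp_all add: field_simps)
    also have "\<dots> = n / fact (n + 1)" by simp
    finally have sr: "s / r < n / fact (n + 1)" .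
    have \<tau>: "of_int k / fact n \<le> \<tau>" "\<tau> < of_int k / fact n + n / fact (n + 1)"
      using sr s \<open>r > 0\<close> by (simp_all add: \<tau>_def t0_def)
    obtain q where q: "q \<in> factorial_cantor m" "\<lfloor>q * fact n\<rfloor> = k" "\<bar>q - \<tau>\<bar> \<le> 2 / fact (n + 2)"
    proof -
      have "\<theta> \<in> factorial_cantor m" "m \<le> n" using \<theta>(1) M(1) n(1) by auto
      then show ?thesis by (rule factorial_cantor_approx[OF _ _ k_def \<tau>]) (rule that)
    qed
    have q\<theta>: "\<bar>q - \<theta>\<bar> < 1 / fact n" using same_cell_dist[of q n \<theta>] q(2) k_def by simp
    then have "q \<in> {c..d}" using M1[of n] M(3) n(1) \<theta>(1) by auto
    moreover
    define h where "h = \<theta> - q"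
    have "cis (- q) * z = of_real r * e * cis h"
      by (simp add: z_eq e_def h_def cis_mult algebra_simps)
    moreover have "p + s *\<^sub>R (- \<i> * e) = of_real r * e * (1 + \<i> * of_real (\<theta> - \<tau>))"
      using \<open>r > 0\<close> by (simp add: p_def \<tau>_def scaleR_conv_of_real field_simps)
    ultimately have "cis (- q) * z - (p + s *\<^sub>R (- \<i> * e)) =
        of_real r * e * ((cis h - 1 - \<i> * of_real h) + \<i> * of_real (\<tau> - q))"
      by (simp add: h_def algebra_simps)
    then have "norm (cis (- q) * z - (p + s *\<^sub>R (- \<i> * e))) =
        r * norm ((cis h - 1 - \<i> * of_real h) + \<i> * of_real (\<tau> - q))"
      using \<open>r > 0\<close> by (simp add: norm_mult e_def)
    also have "\<dots> \<le> r * (h\<^sup>2 + 2 / fact (n + 2))"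
    proof (intro mult_left_mono)
      have "norm (\<i> * complex_of_real (\<tau> - q)) = \<bar>q - \<tau>\<bar>"
        by (simp add: norm_mult abs_minus_commute del: of_real_diff)
      then show "norm ((cis h - 1 - \<i> * of_real h) + \<i> * of_real (\<tau> - q)) \<le> h\<^sup>2 + 2 / fact (n + 2)"
        using norm_cis_linear_le[of h] q(3) norm_triangle_ineq[of "cis h - 1 - \<i> * of_real h" "\<i> * of_real (\<tau> - q)"]
        by linarith
    qed (use \<open>r > 0\<close> in simp)
    \<comment> \<open>curvature of the circle plus the gaps of the Cantor set; both vanish as \<open>n\<close> grows\<close>
    also have "\<dots> \<le> (2 * L * fact (Suc n)) * ((1 / fact n)\<^sup>2 + 2 / fact (n + 2))"
    proof (intro mult_mono add_mono order_refl)
      show "h\<^sup>2 \<le> (1 / fact n)\<^sup>2"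
        using q\<theta> by (intro power2_le_iff_abs_le[THEN iffD2]) (auto simp: h_def abs_minus_commute)
    qed (use n(3) L(1) in auto)
    also have "\<dots> = 2 * L * ((n + 1) / fact n + 2 / (n + 2))"
    proof -
      define f :: real where "f = fact n"
      have "f > 0" by (simp add: f_def)
      then show ?thesis by (simp add: power2_eq_square divide_simps flip: f_def)
    qed
    also have "\<dots> \<le> 2 * L * (2 / (real n - 1) + 2 / (real n - 1))"
    proof (intro mult_left_mono add_mono)
      obtain l where l: "n = Suc l" "l \<ge> 2" using n(1) M(2) by (cases n) auto
      have "real l \<le> fact l" by (metis fact_ge_self of_nat_fact of_nat_le_iff)
      moreover have "(n + 1) / fact n \<le> 2 / fact l"
        using l by (simp add: divide_simps)
      moreover have "2 / fact l \<le> 2 / real l"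
        using l \<open>real l \<le> fact l\<close> by (intro divide_left_mono) auto
      ultimately show "(n + 1) / fact n \<le> 2 / (real n - 1)" using l by simp
      show "2 / (n + 2) \<le> 2 / (real n - 1)" using l by (intro divide_left_mono) auto
    qed (use L(1) in simp)
    also have "\<dots> < \<epsilon> / 2"
    proof -
      have "real M2 \<le> real n - 1" using M(4) n(1) by linarith
      then have "16 * L / \<epsilon> < real n - 1" using M2 by linarith
      moreover have "real n - 1 > 0" using M(2) n(1) by linarith
      ultimately have "8 * L / (real n - 1) < \<epsilon> / 2" using \<open>\<epsilon> > 0\<close> by (simp add: field_simps)
      then show ?thesis by (simp add: mult.commute)
    qed
    finally have close: "norm (cis (- q) * z - (p + s *\<^sub>R (- \<i> * e))) < \<epsilon> / 2" .
    have "norm (cis (- q) * z - (of_int i * e1 + of_int j * e2)) < \<epsilon>"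
      using norm_diff_triangle_less[OF close hit] by simp
    then show "\<exists>q\<in>factorial_cantor m \<inter> {c..d}. \<exists>i j::int.
       norm (cis (- q) * z - (of_int i * e1 + of_int j * e2)) < \<epsilon>"
      using q(1) \<open>q \<in> {c..d}\<close> by blast
  qed
qed

section \<open>Arcs of the circle and arc length\<close>

lemma circle_point_nth [simp]: "circle_point t $ 1 = cos t" "circle_point t $ 2 = sin t"
  by (simp_all add: circle_point_def)

lemma circle_point_in_S1: "circle_point t \<in> S1"
  by (simp add: norm_vec_def L2_set_def sum_2)

lemma continuous_on_circle_point: "continuous_on T circle_point"
proof -
  have eq: "circle_point = (\<lambda>t. cos t *\<^sub>R axis 1 1 + sin t *\<^sub>R axis 2 1)"
    by (auto simp: fun_eq_iff vec_eq_iff forall_2 axis_def)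
  show ?thesis unfolding eq by (intro continuous_intros)
qed

lemma circle_point_eqD:
  assumes "circle_point s = circle_point t"
  obtains k :: int where "s - t = of_int k * (2 * pi)"
proof -
  have "cos s = cos t" "sin s = sin t" using assms by (metis circle_point_nth)+
  then have "cos (s - t) = (cos t)\<^sup>2 + (sin t)\<^sup>2" by (simp add: cos_diff power2_eq_square)
  then have "cos (s - t) = 1" by simp
  then show ?thesis using that unfolding cos_one_2pi_int by (metis mult.assoc mult.commute)
qed

lemma circle_point_inj_on: "inj_on circle_point {0..<2 * pi}"
proof (rule inj_onI)
  fix s t assume st: "s \<in> {0..<2 * pi}" "t \<in> {0..<2 * pi}" "circle_point s = circle_point t"
  then obtain k :: int where k: "s - t = of_int k * (2 * pi)" by (auto elim: circle_point_eqD)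
  have "\<bar>s - t\<bar> < 1 * (2 * pi)" using st by auto
  then have "\<bar>of_int k :: real\<bar> * (2 * pi) < 1 * (2 * pi)" by (simp add: k abs_mult)
  then have "\<bar>of_int k :: real\<bar> < 1" by (rule mult_right_less_imp_less) simp
  then have "k = 0" by linarith
  then show "s = t" using k by simp
qed

lemma circle_point_periodic: "circle_point (t + 2 * pi) = circle_point t"
  by (simp add: circle_point_def)

lemma S1_circle_point:
  assumes "x \<in> S1"
  obtains t where "0 \<le> t" "t < 2 * pi" "x = circle_point t"
proof -
  have "(x $ 1)\<^sup>2 + (x $ 2)\<^sup>2 = 1" using assms by (simp add: norm_vec_def L2_set_def sum_2)
  then obtain t where "0 \<le> t" "t < 2 * pi" "x $ 1 = cos t" "x $ 2 = sin t" by (rule sincos_total_2pi)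
  then show ?thesis using that by (simp add: vec_eq_iff forall_2)
qed

text \<open>Compactness makes the image Borel, so its measure is not the default value 0 of a
  non-measurable set; injectivity on one period makes \<open>T\<close> its exact preimage.\<close>

lemma emeasure_arc_length_circle_point_image:
  assumes "compact T" "T \<subseteq> {0..<2 * pi}"
  shows "emeasure arc_length (circle_point ` T) = emeasure lborel T"
proof -
  have "compact (circle_point ` T)"
    using assms(1) continuous_on_circle_point by (rule compact_continuous_image[rotated])
  then have "circle_point ` T \<in> sets borel" by (intro borel_compact)
  then have "circle_point ` T \<in> sets (restrict_space borel S1)"
    using circle_point_in_S1 by (auto simp: sets_restrict_space_iff)
  moreover have "circle_point -` (circle_point ` T) \<inter> space (restrict_space lborel {0..<2 * pi}) = T"
    using assms(2) circle_point_inj_on by (auto simp: space_restrict_space inj_on_def)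
  ultimately show ?thesis
    unfolding arc_length_def using assms
    by (simp add: emeasure_distr[OF circle_point_measurable] emeasure_restrict_space)
qed

text \<open>Removing one point from each of the two arcs between \<open>s\<close> and
  \<open>t\<close> would disconnect the circle. The second arc runs through the angle 0 and is
  parametrised beyond \<open>2 * pi\<close>.\<close>

lemma connected_circle_subset_contains_arc:
  assumes A: "A \<subseteq> S1" "connected A"
    and st: "0 \<le> s" "s < t" "t < 2 * pi" "circle_point s \<in> A" "circle_point t \<in> A"
  shows "circle_point ` {s..t} \<subseteq> A \<or> circle_point ` {t..s + 2 * pi} \<subseteq> A"
proof (rule ccontr)
  assume "\<not> ?thesis"
  then obtain u w where u: "u \<in> {s..t}" "circle_point u \<notin> A"
    and w: "w \<in> {t..s + 2 * pi}" "circle_point w \<notin> A" by blast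
  have "u \<noteq> s" "u \<noteq> t" "w \<noteq> t" "w \<noteq> s + 2 * pi" using u(2) w(2) st circle_point_periodic by metis+
  then have uw: "s < u" "u < t" "t < w" "w < s + 2 * pi" using u w by auto
  \<comment> \<open>signed distance from the chord through the points at angles \<open>u\<close> and \<open>w\<close>, which separates \<open>s\<close> from \<open>t\<close>\<close>
  define g where "g = (\<lambda>x :: real^2. x \<bullet> circle_point ((u + w) / 2) - cos ((w - u) / 2))"
  have g: "g (circle_point x) = 2 * sin ((x - u) / 2) * sin ((w - x) / 2)" for x
  proof -
    have "g (circle_point x) = cos (x - (u + w) / 2) - cos ((w - u) / 2)"
      by (simp add: g_def inner_vec_def sum_2 cos_diff)
    also have "\<dots> = 2 * sin ((x - u) / 2) * sin ((w - x) / 2)"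
      unfolding cos_diff_cos
      by (rule arg_cong2[where f = "\<lambda>p q. 2 * sin p * sin q"]) (simp_all add: field_simps)
    finally show ?thesis .
  qed
  have sin_flip: "sin ((y - x) / 2) = - sin ((x - y) / 2)" for x y :: real
    by (metis minus_diff_eq minus_divide_left sin_minus)
  have "sin ((t - u) / 2) > 0" "sin ((w - t) / 2) > 0" "sin ((u - s) / 2) > 0" "sin ((w - s) / 2) > 0"
    by (rule sin_gt_zero; use uw st in simp)+
  then have "g (circle_point t) > 0" "g (circle_point s) < 0"
    unfolding g using sin_flip[of s u] by (simp_all add: mult_pos_neg mult_neg_pos)
  moreover have "connected (g ` A)"
    unfolding g_def by (intro connected_continuous_image continuous_intros A)
  ultimately have "0 \<in> g ` A"
    using connectedD_interval[of "g ` A" "g (circle_point s)" "g (circle_point t)" 0] st by auto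
  then obtain x where x: "circle_point x \<in> A" "g (circle_point x) = 0"
    using A(1) S1_circle_point by (smt (verit) image_iff subsetD)
  then have "sin ((x - u) / 2) = 0 \<or> sin ((x - w) / 2) = 0"
    unfolding g using sin_flip[of x w] by auto
  \<comment> \<open>A zero of \<open>g\<close> on the circle can only be one of the chord's two end
    points, and these are not in \<open>A\<close>.\<close>
  moreover have "circle_point x = circle_point y" if xy: "sin ((x - y) / 2) = 0" for y
  proof -
    obtain k :: int where "(x - y) / 2 = of_int k * pi" using xy sin_zero_iff_int2 by blast
    then have x: "x = y + of_int k * (2 * pi)" by (simp add: field_simps)
    have "sin (of_int k * (2 * pi)) = 0" "cos (of_int k * (2 * pi)) = 1"
      using sin_int_2pin[of k] cos_int_2pin[of k] by (simp_all add: mult_ac)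
    then show ?thesis unfolding x by (simp add: circle_point_def sin_add cos_add)
  qed
  ultimately show False using x(1) u(2) w(2) by metis
qed

text \<open>A single point has length zero, so \<open>A\<close> contains two points and with them
  one of the arcs between them.\<close>

lemma arc_of_circle_contains_arc:
  assumes "arc_of_circle A"
  obtains a b where "0 \<le> a" "a < b" "b < 2 * pi" "circle_point ` {a..b} \<subseteq> A"
proof -
  have A: "A \<subseteq> S1" "connected A" "emeasure arc_length A > 0"
    using assms by (auto simp: arc_of_circle_def)
  have "A \<noteq> {}" using A(3) by auto
  then obtain s where s: "0 \<le> s" "s < 2 * pi" "circle_point s \<in> A"
    using A(1) S1_circle_point by (metis ex_in_conv subsetD)
  have "A \<noteq> {circle_point s}"
    using emeasure_arc_length_circle_point_image[of "{s}"] s A(3) by auto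
  then obtain t where t: "0 \<le> t" "t < 2 * pi" "circle_point t \<in> A" "t \<noteq> s"
    using A(1) S1_circle_point s(3) by (smt (verit) insert_iff singletonD subsetD subsetI subset_antisym empty_subsetI insert_subset)
  have "\<exists>a b. 0 \<le> a \<and> a < b \<and> b < 2 * pi \<and> circle_point ` {a..b} \<subseteq> A"
    if "0 \<le> s" "s < t" "t < 2 * pi" "circle_point s \<in> A" "circle_point t \<in> A" for s t
    using connected_circle_subset_contains_arc[OF A(1,2) that]
  proof
    assume "circle_point ` {s..t} \<subseteq> A"
    then show ?thesis using that by blast
  next
    assume sub: "circle_point ` {t..s + 2 * pi} \<subseteq> A"
    \<comment> \<open>An arc that wraps around is cut off before the angle \<open>2 * pi\<close>,
      halfway from \<open>t\<close>.\<close>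
    have "{t..(t + 2 * pi) / 2} \<subseteq> {t..s + 2 * pi}" using that by auto
    then have "circle_point ` {t..(t + 2 * pi) / 2} \<subseteq> A" using sub by blast
    then show ?thesis using that by (intro exI[of _ t] exI[of _ "(t + 2 * pi) / 2"]) auto
  qed
  then show ?thesis using that s t by (metis linorder_neqE_linordered_idom)
qed

section \<open>Independent vectors in a lattice\<close>

lemma lattice_of_int_closed:
  assumes "lattice \<Lambda>" "x \<in> \<Lambda>" "y \<in> \<Lambda>"
  shows "of_int i *\<^sub>R x + of_int j *\<^sub>R y \<in> \<Lambda>"
proof -
  have L: "0 \<in> \<Lambda>" "\<And>x y. x \<in> \<Lambda> \<Longrightarrow> y \<in> \<Lambda> \<Longrightarrow> x + y \<in> \<Lambda>" "\<And>x. x \<in> \<Lambda> \<Longrightarrow> - x \<in> \<Lambda>"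
    using assms(1) by (auto simp: lattice_def)
  have nat: "of_nat k *\<^sub>R x \<in> \<Lambda>" if "x \<in> \<Lambda>" for k :: nat and x
    by (induction k) (use L that in \<open>auto simp: scaleR_add_left\<close>)
  have "of_int k *\<^sub>R x \<in> \<Lambda>" if "x \<in> \<Lambda>" for k :: int and x
  proof (cases k rule: int_cases2)
    case (nonneg n) then show ?thesis using nat[OF that] by simp
  next
    case (nonpos n) then show ?thesis using nat[OF that, of n] L(3) by simp
  qed
  then show ?thesis using assms L(2) by blast
qed

text \<open>Two integrally independent vectors on one real line would have arbitrarily short nonzero
  integer combinations, against discreteness. The pair may span only a sublattice; its neighbourhood
  lies in that of the lattice.\<close>

lemma lattice_basis:
  assumes "lattice \<Lambda>"
  obtains e1 e2 where "e1 \<in> \<Lambda>" "e2 \<in> \<Lambda>" "e1 $ 1 * e2 $ 2 - e1 $ 2 * e2 $ 1 \<noteq> 0"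
proof -
  obtain B where B: "B \<subseteq> \<Lambda>" "card B = 2" "zmod.independent B"
    using assms by (auto simp: lattice_def has_rank_def)
  then obtain e1 e2 where e: "B = {e1, e2}" "e1 \<noteq> e2" by (meson card_2_iff)
  have indep: "k = 0 \<and> h = 0" if "of_int k *\<^sub>R e1 + of_int h *\<^sub>R e2 = 0" for k h :: int
  proof -
    let ?u = "\<lambda>v. if v = e1 then k else h"
    have "(\<Sum>v\<in>B. of_int (?u v) *\<^sub>R v) = 0" using e that by simp
    then have "?u v = 0" if "v \<in> B" for v
      using B(3)[unfolded zmod.independent_explicit_module, rule_format, of B ?u v] that e by simp
    from this[of e1] this[of e2] show ?thesis using e by auto
  qed
  have "e1 \<noteq> 0" using indep[of 1 0] by auto
  have "e1 $ 1 * e2 $ 2 - e1 $ 2 * e2 $ 1 \<noteq> 0"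
  proof
    assume det: "e1 $ 1 * e2 $ 2 - e1 $ 2 * e2 $ 1 = 0"
    define c where "c = (if e1 $ 1 \<noteq> 0 then e2 $ 1 / e1 $ 1 else e2 $ 2 / e1 $ 2)"
    have "e1 $ 1 \<noteq> 0 \<or> e1 $ 2 \<noteq> 0" using \<open>e1 \<noteq> 0\<close> by (auto simp: vec_eq_iff forall_2)
    then have c: "e2 = c *\<^sub>R e1" using det by (auto simp: c_def vec_eq_iff forall_2 field_simps)
    have "0 isolated_in \<Lambda>" using assms by (auto simp: lattice_def discrete_def)
    then obtain d where d: "d > 0" "\<And>y. y \<in> \<Lambda> \<Longrightarrow> dist 0 y < d \<Longrightarrow> y = 0"
      unfolding isolated_in_dist_Ex_iff by blast
    \<comment> \<open>With \<open>norm e1 / N < d\<close>, the Dirichlet approximation of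
      \<open>c\<close> makes \<open>k * e2 - h * e1\<close> shorter than the isolation radius
      \<open>d\<close> of 0.\<close>
    obtain N :: nat where N: "N > 0" "norm e1 / d < real N"
      by (metis d(1) divide_pos_pos \<open>e1 \<noteq> 0\<close> of_nat_0_less_iff order_less_trans reals_Archimedean2 zero_less_norm_iff)
    obtain h k where k: "0 < k" "\<bar>of_int k * c - of_int h\<bar> < 1 / N"
      using Dirichlet_approx[OF N(1)] by metis
    let ?y = "of_int (- h) *\<^sub>R e1 + of_int k *\<^sub>R e2"
    have y: "?y \<in> \<Lambda>" using lattice_of_int_closed[OF assms, of e1 e2] B(1) e by blast
    have "?y = (of_int k * c - of_int h) *\<^sub>R e1" by (simp add: c algebra_simps)
    then have "norm ?y = \<bar>of_int k * c - of_int h\<bar> * norm e1" by simp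
    also have "\<dots> < 1 / N * norm e1" using k \<open>e1 \<noteq> 0\<close> by (intro mult_strict_right_mono) auto
    also have "\<dots> < d" using N d(1) by (simp add: field_simps)
    finally have "?y = 0" using d(2)[OF y] by simp
    then show False using indep k(1) by fastforce
  qed
  then show ?thesis using that B e by blast
qed

section \<open>Passage to complex numbers and construction of the good set\<close>

definition complex_of_vec :: "real^2 \<Rightarrow> complex" where
  "complex_of_vec x = Complex (x $ 1) (x $ 2)"

lemma complex_of_vec_simps [simp]:
  "complex_of_vec (x + y) = complex_of_vec x + complex_of_vec y"
  "complex_of_vec (x - y) = complex_of_vec x - complex_of_vec y"
  "complex_of_vec (a *\<^sub>R x) = of_real a * complex_of_vec x"
  "complex_of_vec (rotation t x) = cis t * complex_of_vec x"
  by (simp_all add: complex_of_vec_def complex_eq_iff rotation_def)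

lemma norm_complex_of_vec [simp]: "norm (complex_of_vec x) = norm x"
  by (simp add: complex_of_vec_def norm_vec_def L2_set_def sum_2 cmod_def)

lemma rotation_rotation_minus: "rotation t (rotation (- t) x) = x"
proof -
  have "complex_of_vec (rotation t (rotation (- t) x)) = complex_of_vec x"
    by (simp add: cis_mult flip: mult.assoc)
  then show ?thesis by (simp add: complex_of_vec_def vec_eq_iff forall_2)
qed

theorem corollary7:
  fixes A :: "(real^2) set"
  assumes "arc_of_circle A"
  shows "\<exists>\<Theta>. \<Theta> \<subseteq> A \<and> closed \<Theta> \<and> emeasure arc_length \<Theta> = 0 \<and> good \<Theta>"
proof -
  obtain a b where ab: "0 \<le> a" "a < b" "b < 2 * pi" "circle_point ` {a..b} \<subseteq> A"
    using arc_of_circle_contains_arc[OF assms] .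
  \<comment> \<open>The middle third supplies the directions, and the outer thirds leave room for
    the approximating angles.\<close>
  define c where "c = a + (b - a) / 3"
  define d where "d = b - (b - a) / 3"
  have cd: "a < c" "c < d" "d < b" "d - c < pi" using ab by (auto simp: c_def d_def field_simps)
  obtain M where "\<And>n. n \<ge> M \<Longrightarrow> 1 / fact n < d - c" using inverse_fact_less[of "d - c"] cd by auto
  then obtain m :: nat where m: "m > 0" "1 / fact m < d - c" by (meson le_add2 lessI less_add_Suc2 less_imp_le zero_less_Suc)
  \<comment> \<open>\<open>of_int k / fact m\<close> is the first multiple of
    \<open>1 / fact m\<close> beyond \<open>c\<close>, hence still below \<open>d\<close>.\<close>
  define k where "k = \<lfloor>c * fact m\<rfloor> + 1"
  have "c * fact m < of_int k" "of_int k \<le> c * fact m + 1" unfolding k_def by linarith+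
  then have "c < of_int k / fact m" "of_int k / fact m \<le> c + 1 / fact m" by (simp_all add: field_simps)
  then have ne: "factorial_cantor m \<inter> {c<..<d} \<noteq> {}"
    using rational_in_factorial_cantor[OF m(1), of k] m(2) by force
  define T where "T = closure (factorial_cantor m \<inter> {a..b})"
  have T: "T \<subseteq> {a..b}" unfolding T_def by (rule closure_minimal) auto
  have "compact T"
    using T by (metis T_def bounded_closed_interval bounded_subset closed_closure compact_eq_bounded_closed)
  have "T \<subseteq> {0..<2 * pi}" using T ab by auto
  have "emeasure arc_length (circle_point ` T) = 0"
    using emeasure_arc_length_circle_point_image[OF \<open>compact T\<close> \<open>T \<subseteq> {0..<2 * pi}\<close>]
      null_closure_factorial_cantor[OF m(1) ab(1)] by (simp add: T_def)
  moreover have "closed (circle_point ` T)"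
    using \<open>compact T\<close> continuous_on_circle_point by (intro compact_imp_closed compact_continuous_image)
  moreover have "circle_point ` T \<subseteq> A" using T ab(4) by blast
  moreover have "good (circle_point ` T)"
    unfolding good_def
  proof (intro conjI allI impI)
    show "circle_point ` T \<subseteq> S1" using circle_point_in_S1 by blast
  next
    fix \<Lambda> and \<epsilon> :: real
    assume "lattice \<Lambda> \<and> \<epsilon> > 0"
    then have \<Lambda>: "lattice \<Lambda>" and \<epsilon>: "\<epsilon> > 0" by auto
    obtain e1 e2 where e: "e1 \<in> \<Lambda>" "e2 \<in> \<Lambda>" "e1 $ 1 * e2 $ 2 - e1 $ 2 * e2 $ 1 \<noteq> 0"
      using lattice_basis[OF \<Lambda>] .
    have "Im (cnj (complex_of_vec e1) * complex_of_vec e2) \<noteq> 0"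
      using e(3) by (simp add: complex_of_vec_def)
    then obtain R where R: "R > 0"
      "\<And>z. norm z \<ge> R \<Longrightarrow> \<exists>q\<in>factorial_cantor m \<inter> {a..b}. \<exists>i j::int.
         norm (cis (- q) * z - (of_int i * complex_of_vec e1 + of_int j * complex_of_vec e2)) < \<epsilon>"
      using factorial_cantor_hits_lattice[OF _ \<epsilon> m(1) cd(1,3,4) ne] by metis
    let ?E = "{x + y | x y. x \<in> \<Lambda> \<and> y \<in> ball 0 \<epsilon>}"
    \<comment> \<open>Rotating \<open>x\<close> back by \<open>q\<close> into the neighbourhood of
      \<Lambda> exhibits \<open>x\<close> as the rotation by \<open>q\<close> of a point
      there.\<close>
    have "x \<in> rotations (circle_point ` T) ?E" if "x \<in> - ball 0 R" for x
    proof -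
      have "norm (complex_of_vec x) \<ge> R" using that by (simp add: not_less)
      then obtain q i j where q: "q \<in> factorial_cantor m \<inter> {a..b}"
        and ij: "norm (cis (- q) * complex_of_vec x -
           (of_int i * complex_of_vec e1 + of_int j * complex_of_vec e2)) < \<epsilon>"
        using R(2) by blast
      define l where "l = of_int i *\<^sub>R e1 + of_int j *\<^sub>R e2"
      have "l \<in> \<Lambda>" unfolding l_def using lattice_of_int_closed[OF \<Lambda> e(1,2)] .
      moreover have "norm (complex_of_vec (rotation (- q) x - l)) < \<epsilon>"
        using ij by (simp add: l_def del: norm_complex_of_vec)
      then have "rotation (- q) x - l \<in> ball 0 \<epsilon>" by (simp del: complex_of_vec_simps)
      moreover have "rotation (- q) x = l + (rotation (- q) x - l)" by simp
      ultimately have mem: "rotation (- q) x \<in> ?E" by blast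
      have pt: "circle_point q \<in> circle_point ` T" using q closure_subset unfolding T_def by blast
      show ?thesis
        unfolding rotations_def
        by (rule CollectI, rule exI[of _ q], rule exI[of _ "rotation (- q) x"],
            rule conjI[OF rotation_rotation_minus[symmetric] conjI[OF pt mem]])
    qed
    then show "good_for \<Lambda> \<epsilon> (circle_point ` T)"
      unfolding good_for_def using R(1) by (intro exI[of _ 0] exI[of _ R]) blast
  qed
  ultimately show ?thesis by blast
qed

end
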